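(* Let $\mu$ be a probability distribution on $\mathbb{N}$ such that $(\mu(n),n\ge1)$ is non-increasing. Then $\mu$ has a well-defined deterministic type $d\in\mathbb{N}\cup\{\infty\}$, and the set of non-freezing bins of the infinite-bin model $\widehat{X}$ started from the single infinite barrier at $0$ is the interval $$\{k\in\mathbb{Z}:\ \widehat{X}_\infty(k)=\infty\}=\{k\in\mathbb{Z}:\ 0\le k\le d-1\}\quad\text{almost surely}$$ (the right-hand side being $\{0,1,2,\ldots\}$ when $d=\infty$).
   Context: $\mathbb{N}=\{1,2,\ldots\}$ and $\mathbb{Z}_+=\{0,1,2,\ldots\}$. The set of configurations is $$\mathcal{S}=\Big\{X:\mathbb{Z}\to\mathbb{Z}_+\cup\{\infty\}\ :\ \sup\{j\in\mathbb{Z}: X(j)\neq 0\}\in(-\infty,\infty)\Big\};$$ $X(j)$ is the number of balls in the bin at position $j$ (so a configuration has at least one ball, and bins far enough to the right are empty). For $X\in\mathcal{S}$ and $k\in\mathbb{N}$, let $B(X,k)=\sup\{j\in\mathbb{Z}:\sum_{i=j}^\infty X(i)\ge k\}$ (location of the $k$th rightmost ball), with $\sup\emptyset=-\infty$. For $\xi\in\mathbb{N}$ define $\Phi_\xi:\mathcal{S}\to\mathcal{S}$ by $\Phi_\xi(X)(j)=X(j)+\mathbf{1}_{\{j=B(X,\xi)+1\}}$ for all $j\in\mathbb{Z}$ if $B(X,\xi)>-\infty$, and $\Phi_\xi(X)=X$ otherwise. Given a probability distribution $\mu$ on $\mathbb{N}$ and $X_0\in\mathcal{S}$ (deterministic),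 the infinite-bin model (IBM) with reproduction law $\mu$ started from $X_0$ is the process defined by $X_{n+1}=\Phi_{\xi_{n+1}}(X_n)$, $n\ge 0$, where $(\xi_n)_{n\ge1}$ are i.i.d. with law $\mu$. Since $X_n(k)$ is non-decreasing in $n$, the limit $X_\infty(k)=\lim_{n\to\infty}X_n(k)\in\mathbb{Z}_+\cup\{\infty\}$ exists for every $k\in\mathbb{Z}$. $(\widehat{X}_n)_{n\ge0}$ denotes the IBM with reproduction law $\mu$ started from the configuration $\widehat{X}_0$ with $\widehat{X}_0(0)=\infty$ and $\widehat{X}_0(k)=0$ for $k\ne0$. For a deterministic $d\in\mathbb{N}\cup\{\infty\}$, $\mu$ is said to be of type $d$ if $d=\inf\{k\ge1:\widehat{X}_\infty(k)<+\infty\}$ almost surely (with $\inf\emptyset=\infty$). *)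

theory Defs
  imports "HOL-Probability.Probability"
begin

type_synonym config = "int \<Rightarrow> enat"

definition configs :: "config set" where
  "configs = {X. {j. X j \<noteq> 0} \<noteq> {} \<and> bdd_above {j. X j \<noteq> 0}}"

text \<open>Position of the \<open>k\<close>-th rightmost ball; \<open>Sup {} = -\<infinity>\<close> in \<^typ>\<open>ereal\<close>.\<close>

definition ball_pos :: "config \<Rightarrow> nat \<Rightarrow> ereal" where
  "ball_pos X k =
     Sup ((\<lambda>j. ereal (real_of_int j)) ` {j. (\<Sum>\<^sub>\<infinity>i\<in>{j..}. X i) \<ge> enat k})"

definition push :: "nat \<Rightarrow> config \<Rightarrow> config" where
  "push x X =
     (if ball_pos X x > -\<infinity>
      then (\<lambda>j. X j + (if ereal (real_of_int j) = ball_pos X x + 1 then 1 else 0))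
      else X)"

lemma push_in_configs:
  assumes "X \<in> configs"
  shows "push x X \<in> configs"
proof -
  let ?T = "{j. ereal (real_of_int j) = ball_pos X x + 1}"
  have "finite ?T"
  proof (cases "?T = {}")
    case False
    then obtain a where "a \<in> ?T" by blast
    then have "?T \<subseteq> {a}" by auto (metis ereal.inject of_int_eq_iff)
    then show ?thesis by (rule finite_subset) simp
  qed simp
  then have "bdd_above ({j. X j \<noteq> 0} \<union> ?T)"
    using assms by (simp add: configs_def bdd_above_Un)
  then have "bdd_above {j. push x X j \<noteq> 0}"
    by (rule bdd_above_mono) (auto simp: push_def split: if_splits)
  moreover have "{j. X j \<noteq> 0} \<subseteq> {j. push x X j \<noteq> 0}"
    by (auto simp: push_def)
  ultimately show ?thesis
    using assms unfolding configs_def by blast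
qed

text \<open>The driving sequence is indexed from 1; its value at 0 is never used.\<close>

primrec ibm :: "config \<Rightarrow> (nat \<Rightarrow> nat) \<Rightarrow> nat \<Rightarrow> config" where
  "ibm X0 \<xi> 0 = X0"
| "ibm X0 \<xi> (Suc n) = push (\<xi> (Suc n)) (ibm X0 \<xi> n)"

definition ibm_lim :: "config \<Rightarrow> (nat \<Rightarrow> nat) \<Rightarrow> config" where
  "ibm_lim X0 \<xi> k = lim (\<lambda>n. ibm X0 \<xi> n k)"

lemma incseq_ibm: "incseq (\<lambda>n. ibm X0 \<xi> n k)"
  by (rule incseq_SucI) (simp add: push_def)

lemma ibm_tendsto_ibm_lim: "(\<lambda>n. ibm X0 \<xi> n k) \<longlonglongrightarrow> ibm_lim X0 \<xi> k"
  using LIMSEQ_SUP[OF incseq_ibm] unfolding ibm_lim_def by (metis limI)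

definition barrier :: config where
  "barrier = (\<lambda>k. if k = 0 then \<infinity> else 0)"

lemma barrier_in_configs: "barrier \<in> configs"
  by (simp add: configs_def barrier_def)

definition iid_with_law :: "'a measure \<Rightarrow> nat pmf \<Rightarrow> (nat \<Rightarrow> 'a \<Rightarrow> nat) \<Rightarrow> bool" where
  "iid_with_law M \<mu> \<xi> \<longleftrightarrow>
     prob_space M \<and>
     prob_space.indep_vars M (\<lambda>_. count_space UNIV) \<xi> {1..} \<and>
     (\<forall>n\<ge>1. distr M (count_space UNIV) (\<xi> n) = measure_pmf \<mu>)"

text \<open>
  The type is a property of \<open>\<mu>\<close> alone, so it is defined on the canonical space of i.i.d.
  sequences; \<open>Inf {} = \<infinity>\<close> in \<^typ>\<open>enat\<close>.
\<close>

definition has_type :: "nat pmf \<Rightarrow> enat \<Rightarrow> bool" where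
  "has_type \<mu> d \<longleftrightarrow> d \<ge> 1 \<and>
     (AE \<xi> in PiM {1..} (\<lambda>_. measure_pmf \<mu>).
        d = Inf (enat ` {k. k \<ge> 1 \<and> ibm_lim barrier \<xi> (int k) < \<infinity>}))"

end

theory Submission
  imports Defs
begin

text \<open>
  Let \<open>R\<^sub>k(n)\<close> be the number of balls strictly to the right of bin \<open>k\<close> after \<open>n\<close> steps from the
  single barrier at 0 (\<open>beyond\<close> below). The barrier supplies infinitely many balls, so each step
  places exactly one ball to the right of bin 0, and \<open>R\<^sub>0(n) = n\<close>. The step with \<open>\<xi>\<^sub>n\<^sub>+\<^sub>1 = x\<close>
  places it to the right of bin \<open>k + 1\<close> exactly when the \<open>x\<close>-th rightmost ball lies to the right of
  bin \<open>k\<close>, that is, when \<open>x \<le> R\<^sub>k(n)\<close>. The whole process is thus an autonomous cascade of counters,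
  \<open>R\<^sub>k\<^sub>+\<^sub>1\<close> being driven by \<open>R\<^sub>k\<close>, and bin \<open>k + 1\<close> is finite in the limit iff \<open>R\<^sub>k - R\<^sub>k\<^sub>+\<^sub>1\<close> is bounded.

  Everything rests on one estimate: for all \<open>k\<close> and \<open>j\<close>, almost surely \<open>\<xi>\<^sub>n\<^sub>+\<^sub>1 = R\<^sub>k(n) - j\<close> for only
  finitely many \<open>n\<close> (\<open>AE_rare_hits\<close>). By independence the expected number of such \<open>n\<close> is the sum over
  \<open>l\<close> of \<open>\<mu>(l - j)\<close> times the expected time that \<open>R\<^sub>k\<close> spends at level \<open>l\<close>. Whenever \<open>R\<^sub>k\<close> is at a level
  \<open>l \<ge> 1\<close>, the choice \<open>\<xi> = 1\<close> raises it, so that time is at most \<open>1 / \<mu>(1)\<close>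
  (\<open>expected_sojourn_le\<close>), and the sum is at most \<open>1 / \<mu>(1)\<close> because \<open>\<mu>\<close> has total mass 1.
  Monotonicity of \<open>\<mu>\<close> enters through \<open>\<mu>(1) > 0\<close>.

  Two consequences are deterministic on the event that all these hit sets are finite. If bin
  \<open>k + 1\<close> freezes with at most \<open>C\<close> balls, then \<open>R\<^sub>k - R\<^sub>k\<^sub>+\<^sub>1 \<le> C\<close>, and bin \<open>k + 2\<close> gains a ball only
  when \<open>R\<^sub>k - C \<le> \<xi> \<le> R\<^sub>k\<close>, which happens finitely often; hence frozen bins form an up-set
  (\<open>freezes_Suc\<close>). And restarting the model from the barrier at time \<open>m\<close> changes each counter by a
  bounded amount only, since the two versions of \<open>R\<^sub>k\<^sub>+\<^sub>1\<close> move apart only when \<open>\<xi>\<close> falls between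
  the two versions of \<open>R\<^sub>k\<close> (\<open>beyond_le_shift\<close>); hence freezing of a bin depends only on the tail of
  the driving sequence (\<open>freezes_shift_iff\<close>). Kolmogorov's zero-one law then makes freezing of
  each bin deterministic (\<open>freezes_zero_one\<close>), which gives the type, and the up-set property
  gives the interval.
\<close>

section \<open>Counting balls to the right of a bin\<close>

primrec beyond :: "(nat \<Rightarrow> nat) \<Rightarrow> nat \<Rightarrow> nat \<Rightarrow> nat" where
  "beyond \<xi> 0 k = 0"
| "beyond \<xi> (Suc n) k =
     beyond \<xi> n k + (if k = 0 \<or> \<xi> (Suc n) \<le> beyond \<xi> n (k - 1) then 1 else 0)"

lemma beyond_0 [simp]: "beyond \<xi> n 0 = n"
  by (induction n) auto

lemma beyond_Suc_le: "beyond \<xi> n (Suc k) \<le> beyond \<xi> n k"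
proof (induction n arbitrary: k)
  case (Suc n)
  from Suc[of k] Suc[of "k - 1"] show ?case
    by (cases k) auto
qed simp

lemma antimono_beyond: "antimono (beyond \<xi> n)"
  by (rule decseq_SucI) (rule beyond_Suc_le)

lemma mono_beyond: "mono (\<lambda>n. beyond \<xi> n k)"
  by (rule incseq_SucI) simp

lemma beyond_le: "beyond \<xi> n k \<le> n"
  by (induction n) auto

text \<open>
  Each step reaches at most one bin further: after \<open>n\<close> steps the front is at bin \<open>n\<close> or to the
  left of it.
\<close>

lemma beyond_eq_0:
  assumes "\<forall>n\<ge>1. \<xi> n \<ge> 1"
  shows "n \<le> k \<Longrightarrow> beyond \<xi> n k = 0"
proof (induction n arbitrary: k)
  case (Suc n)
  then show ?case using assms[rule_format, of "Suc n"] by auto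
qed simp

section \<open>The counters describe the infinite-bin model\<close>

text \<open>
  The configuration with an infinite bin at 0, nothing to its left, and \<open>R k\<close> balls strictly to the
  right of bin \<open>k\<close>. It is determined by its right tails, in which the dynamics is simplest.
\<close>

definition profile :: "(nat \<Rightarrow> nat) \<Rightarrow> config" where
  "profile R j =
     (if j < 0 then 0 else if j = 0 then \<infinity> else enat (R (nat j - 1) - R (nat j)))"

lemma profile_neg [simp]: "j < 0 \<Longrightarrow> profile R j = 0"
  and profile_zero [simp]: "profile R 0 = \<infinity>"
  and profile_Suc [simp]: "profile R (int k + 1) = enat (R k - R (Suc k))"
  by (auto simp: profile_def nat_add_distrib)

lemma infsum_profile_bin_zero:
  assumes "j \<le> 0"
  shows "(\<Sum>\<^sub>\<infinity>i\<in>{j..}. profile R i) = \<infinity>"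
proof -
  have "profile R 0 = (\<Sum>\<^sub>\<infinity>i\<in>{0}. profile R i)"
    by simp
  also have "\<dots> \<le> (\<Sum>\<^sub>\<infinity>i\<in>{j..}. profile R i)"
    using assms
    by (intro infsum_mono_neutral) (auto intro: nonneg_summable_on_complete)
  finally show ?thesis
    by simp
qed

lemma sum_profile:
  assumes "antimono R"
  shows "(\<Sum>i\<in>{int k + 1..int (k + m)}. profile R i) = enat (R k - R (k + m))"
proof (induction m)
  case (Suc m)
  have "{int k + 1..int (k + Suc m)} = insert (int (k + m) + 1) {int k + 1..int (k + m)}"
    by auto
  moreover have "R (k + m) \<le> R k" "R (Suc (k + m)) \<le> R (k + m)"
    using assms by (auto intro: antimonoD)
  ultimately show ?case
    using Suc by (simp del: of_nat_add)
qed (simp add: zero_enat_def)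

lemma infsum_profile:
  assumes "antimono R" "R K = 0"
  shows "(\<Sum>\<^sub>\<infinity>i\<in>{int k + 1..}. profile R i) = enat (R k)"
proof -
  have zero: "R i = 0" if "i \<ge> K" for i
    using antimonoD[OF assms(1) that] assms(2) by simp
  have "profile R i = 0" if "i \<ge> int (k + K) + 1" for i
  proof -
    have "profile R (int (nat i - 1) + 1) = 0"
      using that by (subst profile_Suc) (simp add: zero zero_enat_def)
    then show ?thesis
      using that by (simp add: of_nat_diff)
  qed
  then have "(\<Sum>\<^sub>\<infinity>i\<in>{int k + 1..}. profile R i) = (\<Sum>\<^sub>\<infinity>i\<in>{int k + 1..int (k + K)}. profile R i)"
    by (intro infsum_cong_neutral) auto
  also have "\<dots> = enat (R k - R (k + K))"
    by (simp only: infsum_finite finite_atLeastAtMost_int sum_profile[OF assms(1)])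
  finally show ?thesis
    by (simp add: zero)
qed

text \<open>
  The hypothesis on \<open>b\<close> says that at least \<open>x\<close> balls lie in bin \<open>k\<close> or to the right of it exactly for
  \<open>k \<le> b\<close>. Bin 0 always qualifies because of the barrier, which is the disjunct \<open>k = 0\<close>.
\<close>

lemma ball_pos_profile:
  assumes "antimono R" "R K = 0"
    and b: "\<And>k. k = 0 \<or> x \<le> R (k - 1) \<longleftrightarrow> k \<le> b"
  shows "ball_pos (profile R) x = ereal (real b)"
proof -
  have iff: "enat x \<le> (\<Sum>\<^sub>\<infinity>i\<in>{j..}. profile R i) \<longleftrightarrow> j \<le> int b" for j
  proof (cases "j \<le> 0")
    case True
    then show ?thesis by (simp add: infsum_profile_bin_zero)
  next
    case False
    then obtain k where "j = int k + 1"
      by (metis add.commute not_le zless_iff_Suc_zadd of_nat_Suc add_0)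
    then show ?thesis
      using b[of "Suc k"] by (auto simp: infsum_profile[OF assms(1,2)])
  qed
  have "{j. enat x \<le> (\<Sum>\<^sub>\<infinity>i\<in>{j..}. profile R i)} = {..int b}"
    using iff by auto
  then show ?thesis
    unfolding ball_pos_def by (auto intro!: Sup_eqI)
qed

text \<open>
  If \<open>b\<close> is the bin of the \<open>x\<close>-th rightmost ball, the new ball goes to \<open>b + 1\<close> and so raises the
  counters of exactly the bins \<open>k \<le> b\<close>. Those are the bins with \<open>k = 0\<close> or \<open>x \<le> R (k - 1)\<close>.
\<close>

lemma push_profile:
  assumes "antimono R" "R K = 0" "x \<ge> 1"
  shows "push x (profile R) = profile (\<lambda>k. R k + (if k = 0 \<or> x \<le> R (k - 1) then 1 else 0))"
proof -
  define b where "b = (LEAST b. R b < x)"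
  have "R b < x"
    unfolding b_def by (rule LeastI[of _ K]) (use assms in auto)
  have b: "k = 0 \<or> x \<le> R (k - 1) \<longleftrightarrow> k \<le> b" for k
  proof (cases k)
    case (Suc k')
    have "x \<le> R k' \<longleftrightarrow> k' < b"
    proof
      assume "x \<le> R k'"
      then show "k' < b"
        using \<open>R b < x\<close> antimonoD[OF assms(1), of b k'] by (meson leD leI le_less_trans less_le_trans)
    next
      assume "k' < b"
      then show "x \<le> R k'"
        unfolding b_def using not_less_Least by (metis not_le)
    qed
    with Suc show ?thesis by auto
  qed simp
  have bp: "ball_pos (profile R) x = ereal (real b)"
    by (rule ball_pos_profile[OF assms(1,2) b])
  \<comment> \<open>the position tested by \<^const>\<open>push\<close>, read back as an integer\<close>
  have mid: "ereal (real_of_int j) = ereal (real b) + 1 \<longleftrightarrow> j = int b + 1" for j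
    by (auto simp: one_ereal_def)
  show ?thesis
  proof
    fix j :: int
    consider "j < 0" | "j = 0" | k where "j = int k + 1"
      by (metis add.commute not_less_iff_gr_or_eq zless_iff_Suc_zadd of_nat_Suc add_0)
    then show "push x (profile R) j =
        profile (\<lambda>k. R k + (if k = 0 \<or> x \<le> R (k - 1) then 1 else 0)) j"
    proof cases
      case 3
      have "R (Suc k) \<le> R k"
        using assms(1) by (simp add: antimonoD)
      then show ?thesis
        unfolding push_def bp mid b 3 profile_Suc by (auto simp: one_enat_def)
    qed (auto simp: push_def bp mid)
  qed
qed

lemma ibm_barrier_eq_profile:
  assumes "\<forall>n\<ge>1. \<xi> n \<ge> 1"
  shows "ibm barrier \<xi> n = profile (beyond \<xi> n)"
proof (induction n)
  case 0
  show ?case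
    by (auto simp: barrier_def profile_def zero_enat_def)
next
  case (Suc n)
  have "beyond \<xi> n n = 0"
    by (rule beyond_eq_0[OF assms]) auto
  with assms show ?case
    by (simp add: Suc.IH push_profile[OF antimono_beyond] cong: if_cong)
qed

text \<open>
  The bin concerned is bin \<open>k + 1\<close>, whose content is the difference of the two counters.
\<close>

definition freezes :: "(nat \<Rightarrow> nat) \<Rightarrow> nat \<Rightarrow> bool" where
  "freezes \<xi> k \<longleftrightarrow> (\<exists>C. \<forall>n. beyond \<xi> n k \<le> beyond \<xi> n (Suc k) + C)"

lemma ibm_lim_eq_SUP: "ibm_lim X \<xi> k = (SUP n. ibm X \<xi> n k)"
  using LIMSEQ_SUP[OF incseq_ibm] ibm_tendsto_ibm_lim LIMSEQ_unique by blast

lemma ibm_lim_barrier_Suc_finite_iff: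
  assumes "\<forall>n\<ge>1. \<xi> n \<ge> 1"
  shows "ibm_lim barrier \<xi> (int k + 1) < \<infinity> \<longleftrightarrow> freezes \<xi> k"
proof
  assume "ibm_lim barrier \<xi> (int k + 1) < \<infinity>"
  then obtain C where C: "(SUP n. ibm barrier \<xi> n (int k + 1)) = enat C"
    unfolding ibm_lim_eq_SUP by auto
  have "ibm barrier \<xi> n (int k + 1) \<le> enat C" for n
    unfolding C[symmetric] by (rule SUP_upper) simp
  then have "beyond \<xi> n k \<le> beyond \<xi> n (Suc k) + C" for n
    by (simp add: ibm_barrier_eq_profile[OF assms]) (metis add.commute le_diff_conv)
  then show "freezes \<xi> k"
    unfolding freezes_def by blast
next
  assume "freezes \<xi> k"
  then obtain C where "\<And>n. beyond \<xi> n k \<le> beyond \<xi> n (Suc k) + C"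
    unfolding freezes_def by blast
  then have "ibm barrier \<xi> n (int k + 1) \<le> enat C" for n
    unfolding ibm_barrier_eq_profile[OF assms] profile_Suc by (simp add: le_diff_conv add.commute)
  then have "ibm_lim barrier \<xi> (int k + 1) \<le> enat C"
    unfolding ibm_lim_eq_SUP by (rule SUP_least)
  then show "ibm_lim barrier \<xi> (int k + 1) < \<infinity>"
    using enat_ord_simps(4) le_less_trans by blast
qed

lemma ibm_lim_barrier_nonpos:
  assumes "\<forall>n\<ge>1. \<xi> n \<ge> 1"
  shows "k < 0 \<Longrightarrow> ibm_lim barrier \<xi> k = 0" "ibm_lim barrier \<xi> 0 = \<infinity>"
  unfolding ibm_lim_eq_SUP by (simp_all add: ibm_barrier_eq_profile[OF assms])

section \<open>Rare hits and their pathwise consequences\<close>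

text \<open>
  A counter \<open>f\<close> that gains on another counter \<open>g\<close> only at finitely many times, by at most one each
  time, stays within bounded distance above it. This is how finiteness of hit sets is turned
  into bounds on counters.
\<close>

lemma bounded_excess:
  fixes f g :: "nat \<Rightarrow> nat"
  assumes "finite S"
    and "\<And>n. f (Suc n) + g n \<le> f n + g (Suc n) + of_bool (n \<in> S)"
  shows "\<exists>C. \<forall>n. f n \<le> g n + C"
proof (intro exI allI)
  fix n
  have "f n \<le> g n + (f 0 + card (S \<inter> {..<n}))"
  proof (induction n)
    case (Suc n)
    have "S \<inter> {..<Suc n} = (if n \<in> S then insert n (S \<inter> {..<n}) else S \<inter> {..<n})"
      by (auto simp: less_Suc_eq)
    then have "card (S \<inter> {..<Suc n}) = card (S \<inter> {..<n}) + of_bool (n \<in> S)"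
      by auto
    with Suc assms(2)[of n] show ?case
      by linarith
  qed simp
  also have "\<dots> \<le> g n + (f 0 + card S)"
    using assms(1) by (simp add: card_mono)
  finally show "f n \<le> g n + (f 0 + card S)" .
qed

text \<open>
  A hit at offset \<open>j\<close> is a step whose mark lies exactly \<open>j\<close> below the current value of a counter. It is
  stated as a sum so that marks exceeding the counter do not produce spurious hits through
  truncated subtraction.
\<close>

definition rare_hits :: "(nat \<Rightarrow> nat) \<Rightarrow> bool" where
  "rare_hits \<xi> \<longleftrightarrow> (\<forall>k j. finite {n. \<xi> (Suc n) + j = beyond \<xi> n k})"

lemma rare_hits_window:
  assumes "rare_hits \<xi>"
  shows "finite {n. \<xi> (Suc n) \<le> beyond \<xi> n k \<and> beyond \<xi> n k \<le> \<xi> (Suc n) + C}"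
proof (rule finite_subset)
  show "{n. \<xi> (Suc n) \<le> beyond \<xi> n k \<and> beyond \<xi> n k \<le> \<xi> (Suc n) + C}
      \<subseteq> (\<Union>j\<le>C. {n. \<xi> (Suc n) + j = beyond \<xi> n k})"
  proof
    fix n assume "n \<in> {n. \<xi> (Suc n) \<le> beyond \<xi> n k \<and> beyond \<xi> n k \<le> \<xi> (Suc n) + C}"
    then show "n \<in> (\<Union>j\<le>C. {n. \<xi> (Suc n) + j = beyond \<xi> n k})"
      by (intro UN_I[of "beyond \<xi> n k - \<xi> (Suc n)"]) auto
  qed
  show "finite (\<Union>j\<le>C. {n. \<xi> (Suc n) + j = beyond \<xi> n k})"
    using assms by (auto simp: rare_hits_def)
qed

text \<open>
  Bin \<open>k + 2\<close> gains a ball only if the mark is at most \<open>R\<^sub>k\<close> and larger than \<open>R\<^sub>k\<^sub>+\<^sub>1\<close>. If bin \<open>k + 1\<close>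
  freezes, \<open>R\<^sub>k\<^sub>+\<^sub>1\<close> is within a constant of \<open>R\<^sub>k\<close>, so such marks lie in a window of fixed width
  below \<open>R\<^sub>k\<close>, and rare hits allow only finitely many of them.
\<close>

lemma freezes_Suc:
  assumes "rare_hits \<xi>" "freezes \<xi> k"
  shows "freezes \<xi> (Suc k)"
proof -
  obtain C where C: "\<And>n. beyond \<xi> n k \<le> beyond \<xi> n (Suc k) + C"
    using assms(2) unfolding freezes_def by blast
  show ?thesis
    unfolding freezes_def
  proof (rule bounded_excess)
    show "finite {n. \<xi> (Suc n) \<le> beyond \<xi> n k \<and> beyond \<xi> n k \<le> \<xi> (Suc n) + C}"
      by (rule rare_hits_window[OF assms(1)])
    show "beyond \<xi> (Suc n) (Suc k) + beyond \<xi> n (Suc (Suc k))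
        \<le> beyond \<xi> n (Suc k) + beyond \<xi> (Suc n) (Suc (Suc k))
          + of_bool (n \<in> {n. \<xi> (Suc n) \<le> beyond \<xi> n k \<and> beyond \<xi> n k \<le> \<xi> (Suc n) + C})" for n
      using C[of n] by auto
  qed
qed

lemma freezes_mono:
  assumes "rare_hits \<xi>" "freezes \<xi> k" "k \<le> l"
  shows "freezes \<xi> l"
  using assms(3,2) by (induction l rule: dec_induct) (auto intro: freezes_Suc[OF assms(1)])

text \<open>
  \<open>shift m \<xi>\<close> drives the model that is restarted from the barrier at time \<open>m\<close>: step \<open>n\<close> of the
  restarted model uses the same mark as step \<open>n + m\<close> of the original one.
\<close>

abbreviation (input) shift :: "nat \<Rightarrow> (nat \<Rightarrow> nat) \<Rightarrow> nat \<Rightarrow> nat" where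
  "shift m \<xi> \<equiv> (\<lambda>i. \<xi> (i + m))"

text \<open>
  At the restart all balls to the right of the barrier are forgotten, and the dynamics is
  monotone in the counters.
\<close>

lemma beyond_shift_le: "beyond (shift m \<xi>) n k \<le> beyond \<xi> (n + m) k"
proof (induction n arbitrary: k)
  case (Suc n)
  from Suc[of k] Suc[of "k - 1"] show ?case
    by auto
qed simp

text \<open>
  Induction along the cascade. The counters of bin 0 differ by \<open>m\<close>. If those of bin \<open>k\<close> differ by at
  most \<open>C\<close>, then the original counter of bin \<open>k + 1\<close> gains on the restarted one only when the mark
  lies in the window of width \<open>C\<close> below the original counter of bin \<open>k\<close>, hence finitely often.
\<close>

lemma beyond_le_shift:
  assumes "rare_hits \<xi>"
  shows "\<exists>C. \<forall>n. beyond \<xi> (n + m) k \<le> beyond (shift m \<xi>) n k + C"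
proof (induction k)
  case 0
  show ?case by auto
next
  case (Suc k)
  then obtain C where C: "\<And>n. beyond \<xi> (n + m) k \<le> beyond (shift m \<xi>) n k + C"
    by blast
  let ?S = "{n. \<xi> (Suc n) \<le> beyond \<xi> n k \<and> beyond \<xi> n k \<le> \<xi> (Suc n) + C}"
  show ?case
  proof (rule bounded_excess)
    show "finite ((\<lambda>n. n + m) -` ?S)"
      by (intro finite_vimageI rare_hits_window[OF assms]) (auto simp: inj_on_def)
    show "beyond \<xi> (Suc n + m) (Suc k) + beyond (shift m \<xi>) n (Suc k)
        \<le> beyond \<xi> (n + m) (Suc k) + beyond (shift m \<xi>) (Suc n) (Suc k)
          + of_bool (n \<in> (\<lambda>n. n + m) -` ?S)" for n
      using C[of n] by auto
  qed
qed

text \<open>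
  Restarting changes each counter, and so the content of each bin, by a bounded amount: along a
  sequence with rare hits, freezing is a tail property.
\<close>

lemma freezes_shift_iff:
  assumes "rare_hits \<xi>"
  shows "freezes (shift m \<xi>) k \<longleftrightarrow> freezes \<xi> k"
proof
  assume "freezes \<xi> k"
  then obtain C where C: "\<And>n. beyond \<xi> n k \<le> beyond \<xi> n (Suc k) + C"
    unfolding freezes_def by blast
  obtain D where D: "\<And>n. beyond \<xi> (n + m) (Suc k) \<le> beyond (shift m \<xi>) n (Suc k) + D"
    using beyond_le_shift[OF assms] by blast
  have "beyond (shift m \<xi>) n k \<le> beyond (shift m \<xi>) n (Suc k) + (D + C)" for n
    using beyond_shift_le[of \<xi> m n k] C[of "n + m"] D[of n] by linarith
  then show "freezes (shift m \<xi>) k"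
    unfolding freezes_def by blast
next
  assume "freezes (shift m \<xi>) k"
  then obtain C where C: "\<And>n. beyond (shift m \<xi>) n k \<le> beyond (shift m \<xi>) n (Suc k) + C"
    unfolding freezes_def by blast
  obtain D where D: "\<And>n. beyond \<xi> (n + m) k \<le> beyond (shift m \<xi>) n k + D"
    using beyond_le_shift[OF assms] by blast
  have "beyond \<xi> n k \<le> beyond \<xi> n (Suc k) + (D + C + m)" for n
  proof (cases "n < m")
    \<comment> \<open>times before the restart contribute at most \<open>m\<close> balls\<close>
    case True
    then show ?thesis using beyond_le[of \<xi> n k] by linarith
  next
    case False
    then obtain n' where "n = n' + m"
      by (metis add.commute le_Suc_ex not_less)
    show ?thesis
      unfolding \<open>n = n' + m\<close>
      using D[of n'] C[of n'] beyond_shift_le[of \<xi> m n' "Suc k"] by linarith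
  qed
  then show "freezes \<xi> k"
    unfolding freezes_def by blast
qed

section \<open>Rare hits occur almost surely\<close>

text \<open>
  The counters at time \<open>n\<close> depend on the first \<open>n\<close> marks only. Measurability is stated for an arbitrary
  space \<open>N\<close> so that it can serve on finite products, on the full sequence space, and for the
  sigma-algebra generated by the marks after a given time.
\<close>

lemma measurable_beyond:
  assumes "\<And>i. 1 \<le> i \<Longrightarrow> i \<le> n \<Longrightarrow> X i \<in> measurable N (count_space UNIV)"
  shows "(\<lambda>\<omega>. beyond (\<lambda>i. X i \<omega>) n k) \<in> measurable N (count_space UNIV)"
  using assms
proof (induction n arbitrary: k)
  case (Suc n)
  have [measurable]: "(\<lambda>\<omega>. beyond (\<lambda>i. X i \<omega>) n l) \<in> measurable N (count_space UNIV)" for l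
    using Suc by simp
  have [measurable]: "X (Suc n) \<in> measurable N (count_space UNIV)"
    using Suc.prems by simp
  show ?case
    by simp
qed simp

lemma measurable_freezes:
  assumes "\<And>i. 1 \<le> i \<Longrightarrow> X i \<in> measurable N (count_space UNIV)"
  shows "Measurable.pred N (\<lambda>\<omega>. freezes (\<lambda>i. X i \<omega>) k)"
proof -
  have [measurable]: "(\<lambda>\<omega>. beyond (\<lambda>i. X i \<omega>) n l) \<in> measurable N (count_space UNIV)" for n l
    using assms by (intro measurable_beyond)
  have "Measurable.pred N (\<lambda>\<omega>. beyond (\<lambda>i. X i \<omega>) n k \<le> b + C)" for n b C
    by measurable
  then have [measurable]: "Measurable.pred N
      (\<lambda>\<omega>. beyond (\<lambda>i. X i \<omega>) n k \<le> beyond (\<lambda>i. X i \<omega>) n (Suc k) + C)" for n C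
    by (rule measurable_compose_countable) measurable
  show ?thesis
    unfolding freezes_def by measurable
qed

locale positive_law =
  fixes \<mu> :: "nat pmf"
  assumes support: "set_pmf \<mu> \<subseteq> {1..}"
    and charges_one: "pmf \<mu> 1 > 0"
begin

abbreviation P :: "(nat \<Rightarrow> nat) measure" where
  "P \<equiv> PiM {1..} (\<lambda>_. measure_pmf \<mu>)"

sublocale prob_space P
  by (intro prob_space_PiM measure_pmf.prob_space_axioms)

lemma measurable_coord:
  assumes "1 \<le> i"
  shows "(\<lambda>\<omega>. \<omega> i) \<in> measurable P (count_space UNIV)"
  using measurable_component_singleton[of i "{1..}" "\<lambda>_. measure_pmf \<mu>"] assms
  by (simp cong: measurable_cong_sets)

lemma measurable_next [measurable]: "(\<lambda>\<omega>. \<omega> (Suc n)) \<in> measurable P (count_space UNIV)"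
  by (rule measurable_coord) simp

lemma measurable_beyond_coord [measurable]:
  "(\<lambda>\<omega>. beyond \<omega> n k) \<in> measurable P (count_space UNIV)"
  by (intro measurable_beyond measurable_coord)

lemma distr_coord:
  assumes "1 \<le> i"
  shows "distr P (measure_pmf \<mu>) (\<lambda>\<omega>. \<omega> i) = measure_pmf \<mu>"
  using assms by (intro distr_PiM_component) (auto intro: measure_pmf.prob_space_axioms)

lemma indep_coords: "indep_vars (\<lambda>_. measure_pmf \<mu>) (\<lambda>i \<omega>. \<omega> i) {1..}"
proof (subst indep_vars_iff_distr_eq_PiM')
  show "distr P P (\<lambda>x. restrict x {1..}) =
      PiM {1..} (\<lambda>i. distr P (measure_pmf \<mu>) (\<lambda>\<omega>. \<omega> i))"
  proof -
    have "distr P P (\<lambda>x. restrict x {1..}) = distr P P (\<lambda>x. x)"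
      by (intro distr_cong) (auto simp: space_PiM)
    also have "\<dots> = P"
      by (simp add: distr_id)
    also have "\<dots> = PiM {1..} (\<lambda>i. distr P (measure_pmf \<mu>) (\<lambda>\<omega>. \<omega> i))"
      by (intro PiM_cong refl distr_coord[symmetric]) simp
    finally show ?thesis .
  qed
  show "random_variable (measure_pmf \<mu>) (\<lambda>\<omega>. \<omega> i)" if "i \<in> {1..}" for i
    using that by (rule measurable_component_singleton)
qed simp

lemma prob_next_and_beyond:
  "prob {\<omega> \<in> space P. \<omega> (Suc n) = i \<and> beyond \<omega> n k = l} =
    pmf \<mu> i * prob {\<omega> \<in> space P. beyond \<omega> n k = l}"
proof -
  let ?N = "\<lambda>J. PiM J (\<lambda>_::nat. measure_pmf \<mu>)"
  have "indep_var (?N {Suc n}) (\<lambda>\<omega>. restrict \<omega> {Suc n}) (?N {1..n}) (\<lambda>\<omega>. restrict \<omega> {1..n})"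
    by (rule indep_var_restrict[OF indep_coords]) auto
  then have ind: "indep_var (count_space UNIV) ((\<lambda>\<eta>. \<eta> (Suc n)) \<circ> (\<lambda>\<omega>. restrict \<omega> {Suc n}))
      (count_space UNIV) ((\<lambda>\<eta>. beyond \<eta> n k) \<circ> (\<lambda>\<omega>. restrict \<omega> {1..n}))"
  proof (rule indep_var_compose)
    have coord: "(\<lambda>\<eta>. \<eta> i) \<in> measurable (?N J) (count_space UNIV)" if "i \<in> J" for i J
      using measurable_component_singleton[OF that, of "\<lambda>_. measure_pmf \<mu>"]
      by (simp cong: measurable_cong_sets)
    show "(\<lambda>\<eta>. \<eta> (Suc n)) \<in> measurable (?N {Suc n}) (count_space UNIV)"
      by (rule coord) simp
    show "(\<lambda>\<eta>. beyond \<eta> n k) \<in> measurable (?N {1..n}) (count_space UNIV)"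
      by (intro measurable_beyond coord) simp
  qed
  \<comment> \<open>the counter at time \<open>n\<close> is a function of the first \<open>n\<close> marks, hence independent of the next one\<close>
  have "beyond (restrict \<omega> {1..n}) m k = beyond \<omega> m k" if "m \<le> n" for \<omega> m k
    using that by (induction m arbitrary: k) auto
  then have restrict: "beyond (restrict \<omega> {1..n}) n k = beyond \<omega> n k" for \<omega>
    by blast
  have "prob {\<omega> \<in> space P. \<omega> (Suc n) = i \<and> beyond \<omega> n k = l} =
      prob {\<omega> \<in> space P. \<omega> (Suc n) = i} * prob {\<omega> \<in> space P. beyond \<omega> n k = l}"
    using indep_varD[OF ind, of "{i}" "{l}"]
    by (simp add: restrict vimage_def Int_def conj_commute del: One_nat_def)
  also have "prob {\<omega> \<in> space P. \<omega> (Suc n) = i} =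
      measure (distr P (measure_pmf \<mu>) (\<lambda>\<omega>. \<omega> (Suc n))) {i}"
    by (subst measure_distr)
       (auto simp: vimage_def Int_def conj_commute simp del: One_nat_def
             intro!: measurable_component_singleton)
  also have "\<dots> = pmf \<mu> i"
    by (subst distr_coord) (simp_all add: measure_pmf_single)
  finally show ?thesis .
qed

text \<open>
  The sum is the expected number of times before \<open>N\<close> that the counter spends at level \<open>l\<close>. At each
  such time the mark 1 raises the counter from \<open>l\<close> to \<open>l + 1\<close>, with probability \<open>\<mu>(1)\<close>
  independently of the past, and the passage from \<open>l\<close> to \<open>l + 1\<close> occurs at most once. The mark 1 does
  raise the counter because the preceding counter is then also at least \<open>l \<ge> 1\<close>; at level 0 this
  fails, as the front may not have arrived yet.
\<close>

lemma expected_sojourn_le: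
  assumes "l \<ge> 1"
  shows "(\<Sum>n<N. prob {\<omega> \<in> space P. beyond \<omega> n k = l}) \<le> 1 / pmf \<mu> 1"
proof -
  let ?E = "\<lambda>n. {\<omega> \<in> space P. beyond \<omega> n k = l \<and> beyond \<omega> (Suc n) k = Suc l}"
  have "pmf \<mu> 1 * prob {\<omega> \<in> space P. beyond \<omega> n k = l} \<le> prob (?E n)" for n
    unfolding prob_next_and_beyond[symmetric]
  proof (rule finite_measure_mono)
    show "{\<omega> \<in> space P. \<omega> (Suc n) = 1 \<and> beyond \<omega> n k = l} \<subseteq> ?E n"
    proof safe
      fix \<omega> assume "\<omega> (Suc n) = 1" "l = beyond \<omega> n k"
      moreover have "beyond \<omega> n k \<le> beyond \<omega> n (k - 1)"
        using antimono_beyond by (rule antimonoD) simp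
      ultimately show "beyond \<omega> (Suc n) k = Suc (beyond \<omega> n k)"
        using assms by simp
    qed
  qed measurable
  then have "pmf \<mu> 1 * (\<Sum>n<N. prob {\<omega> \<in> space P. beyond \<omega> n k = l}) \<le> (\<Sum>n<N. prob (?E n))"
    by (simp add: sum_distrib_left sum_mono)
  also have "\<dots> = prob (\<Union>n<N. ?E n)"
  proof (rule finite_measure_finite_Union[symmetric])
    show "disjoint_family_on ?E {..<N}"
      unfolding disjoint_family_on_def
    proof (intro ballI impI)
      fix m n :: nat
      assume "m \<noteq> n"
      have "?E m \<inter> ?E n = {}" if "m < n" for m n
      proof (rule ccontr)
        assume "?E m \<inter> ?E n \<noteq> {}"
        then obtain \<omega> where "beyond \<omega> (Suc m) k = Suc l" "beyond \<omega> n k = l"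
          by blast
        moreover have "beyond \<omega> (Suc m) k \<le> beyond \<omega> n k"
          using that by (intro monoD[OF mono_beyond]) simp
        ultimately show False by simp
      qed
      from this[of m n] this[of n m] \<open>m \<noteq> n\<close> show "?E m \<inter> ?E n = {}"
        by (cases "m < n") (simp_all add: Int_commute del: beyond.simps)
    qed
    show "?E ` {..<N} \<subseteq> events"
      by (intro image_subsetI) measurable
  qed simp
  also have "\<dots> \<le> 1"
    by (rule prob_le_1)
  finally show ?thesis
    using charges_one by (simp add: field_simps)
qed

text \<open>
  Borel--Cantelli. Splitting a hit according to the value \<open>i\<close> of the mark, the expected number of
  hits is the sum over \<open>i\<close> of \<open>\<mu>(i)\<close> times the expected time spent at level \<open>i + j\<close>. The mark 0 has
  probability 0, and for \<open>i \<ge> 1\<close> the sojourn bound applies uniformly.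
\<close>

lemma AE_rare_hits: "AE \<omega> in P. rare_hits \<omega>"
  unfolding rare_hits_def AE_all_countable
proof (intro allI)
  fix k j
  let ?H = "\<lambda>n. {\<omega> \<in> space P. \<omega> (Suc n) + j = beyond \<omega> n k}"
  have hit: "prob (?H n) = (\<Sum>i\<le>N. pmf \<mu> i * prob {\<omega> \<in> space P. beyond \<omega> n k = i + j})"
    if "n < N" for n N
  proof -
    have "\<omega> (Suc n) \<le> N" if "\<omega> (Suc n) + j = beyond \<omega> n k" for \<omega>
      using that \<open>n < N\<close> beyond_le[of \<omega> n k] by simp
    then have "?H n = (\<Union>i\<le>N. {\<omega> \<in> space P. \<omega> (Suc n) = i \<and> beyond \<omega> n k = i + j})"
      by auto
    then show ?thesis
      unfolding prob_next_and_beyond[symmetric]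
      by (simp only:) (rule finite_measure_finite_Union, auto simp: disjoint_family_on_def simp del: One_nat_def)
  qed
  have "pmf \<mu> 0 = 0"
    using support by (auto simp: pmf_eq_0_set_pmf)
  have "summable (\<lambda>n. prob (?H n))"
  proof (rule summableI_nonneg_bounded)
    fix N
    have "(\<Sum>n<N. prob (?H n)) =
        (\<Sum>i\<le>N. pmf \<mu> i * (\<Sum>n<N. prob {\<omega> \<in> space P. beyond \<omega> n k = i + j}))"
      unfolding sum_distrib_left by (subst sum.swap) (intro sum.cong refl hit, simp)
    also have "\<dots> \<le> (\<Sum>i\<le>N. pmf \<mu> i * (1 / pmf \<mu> 1))"
    proof (rule sum_mono)
      fix i
      show "pmf \<mu> i * (\<Sum>n<N. prob {\<omega> \<in> space P. beyond \<omega> n k = i + j}) \<le> pmf \<mu> i * (1 / pmf \<mu> 1)"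
      proof (cases "i = 0")
        case False
        then show ?thesis
          by (intro mult_left_mono expected_sojourn_le) auto
      qed (simp add: \<open>pmf \<mu> 0 = 0\<close>)
    qed
    also have "\<dots> = measure (measure_pmf \<mu>) {..N} / pmf \<mu> 1"
      by (simp add: measure_measure_pmf_finite sum_divide_distrib)
    also have "\<dots> \<le> 1 / pmf \<mu> 1"
      using charges_one by (intro divide_right_mono) auto
    finally show "(\<Sum>n<N. prob (?H n)) \<le> 1 / pmf \<mu> 1" .
  qed simp
  moreover have "?H n \<in> events" for n
    by measurable
  ultimately have "AE \<omega> in P. eventually (\<lambda>n. \<omega> \<in> space P - ?H n) sequentially"
    by (intro borel_cantelli_AE1) (auto simp only: emeasure_eq_measure ennreal_less_top infinity_ennreal_def)
  then show "AE \<omega> in P. finite {n. \<omega> (Suc n) + j = beyond \<omega> n k}"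
  proof eventually_elim
    case (elim \<omega>)
    then have "eventually (\<lambda>n. \<omega> (Suc n) + j \<noteq> beyond \<omega> n k) cofinite"
      unfolding cofinite_eq_sequentially by (rule eventually_mono) auto
    then show ?case
      by (simp add: eventually_cofinite)
  qed
qed

section \<open>Freezing of a bin is deterministic\<close>

text \<open>
  Freezing itself need not be a tail event, because it is insensitive to a restart only along
  sequences with rare hits. It is therefore replaced by the tail event \<open>?L\<close> that the model
  freezes the bin for infinitely many restart times, which agrees with it almost surely.
\<close>

lemma freezes_zero_one:
  "(AE \<omega> in P. freezes \<omega> k) \<or> (AE \<omega> in P. \<not> freezes \<omega> k)"
proof -
  let ?A = "\<lambda>i. {(\<lambda>\<omega>. \<omega> (Suc i)) -` S \<inter> space P | S :: nat set. True}"
  let ?L = "{\<omega> \<in> space P. \<forall>m0. \<exists>m\<ge>m0. freezes (shift m \<omega>) k}"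
  have tail: "?L \<in> tail_events ?A"
    unfolding tail_events_def
  proof
    fix n
    define N where "N = sigma (space P) (\<Union>i\<in>{n..}. ?A i)"
    have space_N [simp]: "space N = space P"
      unfolding N_def by (rule space_measure_of) auto
    have sets_N: "sets N = sigma_sets (space P) (\<Union>i\<in>{n..}. ?A i)"
      unfolding N_def by (rule sets_measure_of) auto
    have "(\<lambda>\<omega>. \<omega> (i + m)) \<in> measurable N (count_space UNIV)" if "1 \<le> i" "n \<le> m" for i m
    proof (rule measurableI)
      fix S :: "nat set"
      obtain i' where "i + m = Suc i'" "n \<le> i'"
        using \<open>1 \<le> i\<close> \<open>n \<le> m\<close> by (cases i) auto
      then show "(\<lambda>\<omega>. \<omega> (i + m)) -` S \<inter> space N \<in> sets N"
        unfolding sets_N by (intro sigma_sets.Basic) auto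
    qed simp
    then have [measurable]: "Measurable.pred N (\<lambda>\<omega>. freezes (shift (m + n) \<omega>) k)" for m
      by (intro measurable_freezes) simp
    \<comment> \<open>only restarts after time \<open>n\<close> matter, and those see only marks after time \<open>n\<close>\<close>
    have "(\<forall>m0. \<exists>m\<ge>m0. freezes (shift m \<omega>) k) \<longleftrightarrow>
        (\<forall>m0. \<exists>m\<ge>m0. freezes (shift (m + n) \<omega>) k)" for \<omega>
    proof safe
      fix m0
      assume "\<forall>m0. \<exists>m\<ge>m0. freezes (shift m \<omega>) k"
      then obtain m where "m \<ge> m0 + n" "freezes (shift m \<omega>) k"
        by blast
      then show "\<exists>m\<ge>m0. freezes (shift (m + n) \<omega>) k"
        by (intro exI[of _ "m - n"]) auto
    next
      fix m0
      assume "\<forall>m0. \<exists>m\<ge>m0. freezes (shift (m + n) \<omega>) k"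
      then obtain m where "m \<ge> m0" "freezes (shift (m + n) \<omega>) k"
        by blast
      then show "\<exists>m\<ge>m0. freezes (shift m \<omega>) k"
        by (intro exI[of _ "m + n"]) auto
    qed
    then have "?L = {\<omega> \<in> space N. \<forall>m0. \<exists>m\<ge>m0. freezes (shift (m + n) \<omega>) k}"
      by simp
    also have "\<dots> \<in> sets N"
      by measurable
    finally show "?L \<in> sigma_sets (space P) (\<Union>i\<in>{n..}. ?A i)"
      unfolding sets_N .
  qed
  have alg: "sigma_algebra (space P) (?A i)" for i
    using sets.sigma_algebra_axioms[of "vimage_algebra (space P) (\<lambda>\<omega>. \<omega> (Suc i)) (count_space UNIV)"]
    by (simp add: sets_vimage_algebra2)
  have events: "?A i \<subseteq> events" for i
    by (auto intro!: measurable_sets[OF measurable_next])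
  have indep: "indep_sets ?A UNIV"
  proof (rule indep_setsI)
    show "?A i \<subseteq> events" for i
      by (rule events)
    fix E J
    assume J: "J \<noteq> {}" "finite J" and E: "\<forall>j\<in>J. E j \<in> ?A j"
    \<comment> \<open>the zero-one law is indexed from 0, the marks from 1\<close>
    have "indep_sets (\<lambda>i. {(\<lambda>\<omega>. \<omega> i) -` S \<inter> space P | S. S \<in> sets (measure_pmf \<mu>)}) {1..}"
      using indep_coords unfolding indep_vars_def2 by simp
    then have "prob (\<Inter>j\<in>Suc ` J. E (j - 1)) = (\<Prod>j\<in>Suc ` J. prob (E (j - 1)))"
      by (rule indep_setsD) (use J E in auto)
    then show "prob (\<Inter>j\<in>J. E j) = (\<Prod>j\<in>J. prob (E j))"
      by (simp add: prod.reindex)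
  qed
  have "prob ?L = 0 \<or> prob ?L = 1"
    by (rule kolmogorov_0_1_law[OF alg indep tail])
  moreover have "?L \<in> events"
    by (rule subsetD[OF tail_events_sets[OF events] tail])
  ultimately have "(AE \<omega> in P. \<omega> \<notin> ?L) \<or> (AE \<omega> in P. \<omega> \<in> ?L)"
    by (simp only: prob_eq_0 prob_eq_1)
  moreover have "AE \<omega> in P. freezes \<omega> k \<longleftrightarrow> \<omega> \<in> ?L"
    using AE_rare_hits AE_space by eventually_elim (auto simp: freezes_shift_iff)
  ultimately show ?thesis
  proof (elim disjE)
    assume "AE \<omega> in P. freezes \<omega> k \<longleftrightarrow> \<omega> \<in> ?L" "AE \<omega> in P. \<omega> \<in> ?L"
    then have "AE \<omega> in P. freezes \<omega> k"
      by eventually_elim (rule iffD2)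
    then show ?thesis ..
  next
    assume "AE \<omega> in P. freezes \<omega> k \<longleftrightarrow> \<omega> \<in> ?L" "AE \<omega> in P. \<omega> \<notin> ?L"
    then have "AE \<omega> in P. \<not> freezes \<omega> k"
      by eventually_elim (rule contrapos_nn, assumption, erule iffD1)
    then show ?thesis ..
  qed
qed

end

section \<open>Non-freezing bins and the type\<close>

text \<open>
  The minimum of an up-set of positive numbers separates it from its complement. The form
  \<open>\<le> Inf - 1\<close> also covers the empty set, as \<open>\<infinity> - 1 = \<infinity>\<close>.
\<close>

lemma enat_le_Inf_minus_one_iff:
  assumes "0 \<notin> F" "\<And>k l. k \<in> F \<Longrightarrow> k \<le> l \<Longrightarrow> l \<in> F"
  shows "enat k \<le> Inf (enat ` F) - 1 \<longleftrightarrow> k \<notin> F"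
proof -
  have "enat k < Inf (enat ` F) \<longleftrightarrow> k \<notin> F"
  proof
    assume "enat k < Inf (enat ` F)"
    then show "k \<notin> F"
      by (metis Inf_lower imageI not_le)
  next
    assume "k \<notin> F"
    then have "enat (Suc k) \<le> Inf (enat ` F)"
      using assms(2) by (intro Inf_greatest) (auto simp: Suc_le_eq not_le[symmetric])
    then show "enat k < Inf (enat ` F)"
      by (simp add: Suc_ile_eq)
  qed
  moreover have "1 \<le> Inf (enat ` F)"
    using assms(1) by (intro Inf_greatest) (auto simp: one_enat_def Suc_le_eq intro!: gr0I)
  then have "enat k \<le> Inf (enat ` F) - 1 \<longleftrightarrow> enat k < Inf (enat ` F)"
    by (cases "Inf (enat ` F)") (auto simp: one_enat_def)
  ultimately show ?thesis by simp
qed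

lemma ibm_lim_cong:
  assumes "\<And>n. n \<ge> 1 \<Longrightarrow> \<xi> n = \<eta> n"
  shows "ibm_lim X \<xi> = ibm_lim X \<eta>"
proof -
  have "ibm X \<xi> n = ibm X \<eta> n" for n
    using assms by (induction n) auto
  then show ?thesis
    by (simp add: ibm_lim_def fun_eq_iff)
qed

lemma ibm_lim_barrier_finite_iff:
  assumes "\<forall>n\<ge>1. \<xi> n \<ge> 1"
  shows "k \<ge> 1 \<and> ibm_lim barrier \<xi> (int k) < \<infinity> \<longleftrightarrow> k \<ge> 1 \<and> freezes \<xi> (k - 1)"
  using ibm_lim_barrier_Suc_finite_iff[OF assms, of "k - 1"] by (auto simp: of_nat_diff)

text \<open>
  Along a sequence with rare hits the frozen bins \<open>k \<ge> 1\<close> form an up-set, so the non-frozen ones are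
  those before the first frozen bin. The barrier itself is bin 0 and belongs to them.
\<close>

lemma nonfreezing_bins:
  assumes "\<forall>n\<ge>1. \<xi> n \<ge> 1" "rare_hits \<xi>"
  shows "{k. ibm_lim barrier \<xi> k = \<infinity>} =
    {k. 0 \<le> k \<and> enat (nat k) \<le> Inf (enat ` {k. k \<ge> 1 \<and> freezes \<xi> (k - 1)}) - 1}"
proof (intro Collect_cong)
  fix j :: int
  have frozen_up: "enat k \<le> Inf (enat ` {k. k \<ge> 1 \<and> freezes \<xi> (k - 1)}) - 1 \<longleftrightarrow>
      \<not> (k \<ge> 1 \<and> freezes \<xi> (k - 1))" for k
    by (subst enat_le_Inf_minus_one_iff) (auto intro: freezes_mono[OF assms(2)])
  show "ibm_lim barrier \<xi> j = \<infinity> \<longleftrightarrow>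
      0 \<le> j \<and> enat (nat j) \<le> Inf (enat ` {k. k \<ge> 1 \<and> freezes \<xi> (k - 1)}) - 1"
  proof (cases "j < 0")
    case True
    then show ?thesis
      by (simp add: ibm_lim_barrier_nonpos(1)[OF assms(1)])
  next
    case False
    then obtain k where "j = int k"
      by (metis nonneg_int_cases not_less)
    then show ?thesis
      unfolding \<open>j = int k\<close> nat_int frozen_up
      using ibm_lim_barrier_finite_iff[OF assms(1), of k] ibm_lim_barrier_nonpos(2)[OF assms(1)]
      by (cases k) auto
  qed
qed

text \<open>
  The joint law of any i.i.d. sequence is the product measure, so almost sure statements about
  the canonical sequence hold for every realisation of it.
\<close>

lemma AE_canonical_imp_AE:
  assumes "iid_with_law M \<mu> \<xi>" "AE \<eta> in PiM {1..} (\<lambda>_. measure_pmf \<mu>). Q \<eta>"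
  shows "AE \<omega> in M. Q (\<lambda>n\<in>{1..}. \<xi> n \<omega>)"
proof -
  interpret prob_space M
    using assms(1) by (simp add: iid_with_law_def)
  let ?N = "PiM {1..} (\<lambda>_::nat. count_space UNIV :: nat measure)"
  let ?X = "\<lambda>\<omega>. \<lambda>n\<in>{1..}. \<xi> n \<omega>"
  have indep: "indep_vars (\<lambda>_. count_space UNIV) \<xi> {1..}"
    and law: "\<And>n. n \<ge> 1 \<Longrightarrow> distr M (count_space UNIV) (\<xi> n) = measure_pmf \<mu>"
    using assms(1) by (simp_all add: iid_with_law_def)
  have rv: "\<xi> n \<in> measurable M (count_space UNIV)" if "n \<in> {1..}" for n
    using indep that by (simp add: indep_vars_def2)
  have "distr M ?N ?X = PiM {1..} (\<lambda>n. distr M (count_space UNIV) (\<xi> n))"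
    using indep by (subst (asm) indep_vars_iff_distr_eq_PiM') (auto intro: rv)
  also have "\<dots> = PiM {1..} (\<lambda>_. measure_pmf \<mu>)"
    by (intro PiM_cong refl law) simp
  finally have distr: "distr M ?N ?X = PiM {1..} (\<lambda>_. measure_pmf \<mu>)" .
  have "AE \<eta> in distr M ?N ?X. Q \<eta>"
    unfolding distr by (rule assms(2))
  moreover have "?X \<in> measurable M ?N"
    by (intro measurable_restrict rv)
  ultimately show ?thesis
    by (rule AE_distrD[rotated])
qed

context positive_law
begin

lemma AE_positive: "AE \<omega> in P. \<forall>n\<ge>1. \<omega> n \<ge> 1"
  unfolding AE_all_countable
proof (intro allI)
  fix n :: nat
  show "AE \<omega> in P. 1 \<le> n \<longrightarrow> 1 \<le> \<omega> n"
  proof (cases "1 \<le> n")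
    case True
    have "AE \<omega> in P. 1 \<le> \<omega> n"
    proof (rule AE_PiM_component)
      show "AE x in measure_pmf \<mu>. 1 \<le> x"
        using support by (auto simp: AE_measure_pmf_iff)
    qed (use True in \<open>auto intro: measure_pmf.prob_space_axioms\<close>)
    then show ?thesis by simp
  qed simp
qed

lemma AE_freezes_iff: "AE \<omega> in P. \<forall>k. freezes \<omega> k \<longleftrightarrow> (AE \<eta> in P. freezes \<eta> k)"
  unfolding AE_all_countable
proof (intro allI)
  fix k
  from freezes_zero_one[of k] show "AE \<omega> in P. freezes \<omega> k \<longleftrightarrow> (AE \<eta> in P. freezes \<eta> k)"
  proof
    assume *: "AE \<omega> in P. freezes \<omega> k"
    then show ?thesis by simp
  next
    assume *: "AE \<omega> in P. \<not> freezes \<omega> k"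
    have "\<not> (AE \<eta> in P. freezes \<eta> k)"
    proof
      assume "AE \<eta> in P. freezes \<eta> k"
      with * have "AE \<eta> in P. False"
        by eventually_elim simp
      then show False by simp
    qed
    with * show ?thesis by simp
  qed
qed

definition ibm_type :: enat where
  "ibm_type = Inf (enat ` {k. k \<ge> 1 \<and> (AE \<omega> in P. freezes \<omega> (k - 1))})"

lemma has_type_iff: "has_type \<mu> d \<longleftrightarrow> d = ibm_type"
proof -
  have type: "AE \<omega> in P. Inf (enat ` {k. k \<ge> 1 \<and> ibm_lim barrier \<omega> (int k) < \<infinity>}) = ibm_type"
    using AE_positive AE_freezes_iff
  proof eventually_elim
    case (elim \<omega>)
    then show ?case
      unfolding ibm_type_def ibm_lim_barrier_finite_iff[OF elim(1)] by simp
  qed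
  have ge: "1 \<le> ibm_type"
    unfolding ibm_type_def by (intro Inf_greatest) (auto simp: one_enat_def)
  show ?thesis
  proof
    assume "has_type \<mu> d"
    then have "AE \<omega> in P. d = Inf (enat ` {k. k \<ge> 1 \<and> ibm_lim barrier \<omega> (int k) < \<infinity>})"
      by (simp only: has_type_def)
    with type have "AE \<omega> in P. d = ibm_type"
      by eventually_elim simp
    then show "d = ibm_type"
      by simp
  next
    assume "d = ibm_type"
    with type ge show "has_type \<mu> d"
      unfolding has_type_def by (simp only: eq_commute[of ibm_type] simp_thms)
  qed
qed

lemma AE_nonfreezing_bins:
  assumes "iid_with_law M \<mu> \<xi>"
  shows "AE \<omega> in M. {k. ibm_lim barrier (\<lambda>n. \<xi> n \<omega>) k = \<infinity>} =
    {k. 0 \<le> k \<and> enat (nat k) \<le> ibm_type - 1}"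
proof -
  have "AE \<eta> in P. {k. ibm_lim barrier \<eta> k = \<infinity>} = {k. 0 \<le> k \<and> enat (nat k) \<le> ibm_type - 1}"
    using AE_positive AE_rare_hits AE_freezes_iff
  proof eventually_elim
    case (elim \<eta>)
    then show ?case
      unfolding ibm_type_def nonfreezing_bins[OF elim(1,2)] by simp
  qed
  from AE_canonical_imp_AE[OF assms this] show ?thesis
  proof eventually_elim
    case (elim \<omega>)
    have "ibm_lim barrier (\<lambda>n\<in>{1..}. \<xi> n \<omega>) = ibm_lim barrier (\<lambda>n. \<xi> n \<omega>)"
      by (rule ibm_lim_cong) simp
    with elim show ?case by simp
  qed
qed

end

theorem corollary1p6:
  fixes \<mu> :: "nat pmf"
  assumes "set_pmf \<mu> \<subseteq> {1..}"
    and "antimono_on {1..} (pmf \<mu>)"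
  shows "(\<exists>!d. has_type \<mu> d) \<and>
    (\<forall>d. has_type \<mu> d \<longrightarrow>
      (\<forall>(M :: 'a measure) \<xi>. iid_with_law M \<mu> \<xi> \<longrightarrow>
        (AE \<omega> in M. {k :: int. ibm_lim barrier (\<lambda>n. \<xi> n \<omega>) k = \<infinity>} =
                     {k :: int. 0 \<le> k \<and> enat (nat k) \<le> d - 1})))"
proof -
  obtain n where "n \<in> set_pmf \<mu>"
    using set_pmf_not_empty by fast
  then have "1 \<le> n" "0 < pmf \<mu> n"
    using assms(1) by (auto simp: pmf_positive)
  then have "0 < pmf \<mu> 1"
    using monotone_onD[OF assms(2), of 1 n] by simp
  then interpret positive_law \<mu>
    using assms(1) by unfold_locales
  show ?thesis
    unfolding has_type_iff using AE_nonfreezing_bins by blast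
qed

end
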